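(* Let $n\geq 1$ and $w\in S_n$. Let $\nu_w:=\mathfrak S_w(1,1,\ldots,1)$ be the Schubert polynomial of $w$ evaluated with all variables equal to $1$, and let $\eta_w:=\#\{(i,j,k): 1\leq i<j<k\leq n \text{ and } w(i)<w(k)<w(j)\}$ be the number of occurrences of the pattern $132$ in $w$. Then $\nu_w\geq \eta_w+1$.
   Context: Schubert polynomials (Lascoux–Schützenberger): for the longest permutation $w_0=n\,n-1\,\ldots\,1\in S_n$, set $\mathfrak S_{w_0}:=x_1^{n-1}x_2^{n-2}\cdots x_{n-1}$. For any other $w\in S_n$ choose $i$ with $w(i)<w(i+1)$ and set $\mathfrak S_w:=\partial_i\mathfrak S_{ws_i}$, where $s_i=(i,i+1)$, $\partial_i f:=\frac{f-s_if}{x_i-x_{i+1}}$, and $s_i$ acts on polynomials by exchanging $x_i$ and $x_{i+1}$ (this is well defined). *)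

theory Defs
  imports
    "HOL-Library.Poly_Mapping"
    "HOL-Combinatorics.Permutations"
begin

text \<open>
  Integer polynomials in the variables \<open>x\<^sub>0, x\<^sub>1, x\<^sub>2, \<dots>\<close>: finitely supported maps from
  monomials (themselves finitely supported exponent vectors) to coefficients.
  The ring structure is the convolution ring of \<^theory>\<open>HOL-Library.Poly_Mapping\<close>.
\<close>

type_synonym int_mpoly = "(nat \<Rightarrow>\<^sub>0 nat) \<Rightarrow>\<^sub>0 int"

definition var :: "nat \<Rightarrow> int_mpoly" where
  "var i = Poly_Mapping.single (Poly_Mapping.single i 1) 1"

definition subst_mpoly :: "(nat \<Rightarrow> 'a::comm_ring_1) \<Rightarrow> int_mpoly \<Rightarrow> 'a" where
  "subst_mpoly \<sigma> f =
     (\<Sum>m\<in>Poly_Mapping.keys f. of_int (Poly_Mapping.lookup f m) *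
        (\<Prod>v\<in>Poly_Mapping.keys m. \<sigma> v ^ Poly_Mapping.lookup m v))"

definition swap_vars :: "nat \<Rightarrow> int_mpoly \<Rightarrow> int_mpoly" where
  "swap_vars i = subst_mpoly (\<lambda>v. var (transpose i (i + 1) v))"

text \<open>
  The quotient exists and is unique for every \<open>f\<close>; see \<open>divided_diff_ex1\<close> below.
\<close>

definition divided_diff :: "nat \<Rightarrow> int_mpoly \<Rightarrow> int_mpoly" where
  "divided_diff i f = (THE g. (var i - var (i + 1)) * g = f - swap_vars i f)"

definition longest_perm :: "nat \<Rightarrow> nat \<Rightarrow> nat" where
  "longest_perm n i = (if i \<in> {1..n} then n + 1 - i else i)"

text \<open>
  \<open>is_schubert n w f\<close>: the polynomial \<open>f\<close> is obtained for \<open>w \<in> S\<^sub>n\<close> by some sequence of choices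
  in the recursive definition. That the result exists and does not depend on the choices is
  \<open>is_schubert_ex1\<close> below.
\<close>

inductive is_schubert :: "nat \<Rightarrow> (nat \<Rightarrow> nat) \<Rightarrow> int_mpoly \<Rightarrow> bool" for n where
  longest: "is_schubert n (longest_perm n) (\<Prod>i\<in>{1..n}. var i ^ (n - i))"
| step: "\<lbrakk>w permutes {1..n}; 1 \<le> i; i < n; w i < w (i + 1);
          is_schubert n (w \<circ> transpose i (i + 1)) f\<rbrakk>
         \<Longrightarrow> is_schubert n w (divided_diff i f)"

definition schubert :: "nat \<Rightarrow> (nat \<Rightarrow> nat) \<Rightarrow> int_mpoly" where
  "schubert n w = (THE f. is_schubert n w f)"

definition principal_spec :: "nat \<Rightarrow> (nat \<Rightarrow> nat) \<Rightarrow> int" where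
  "principal_spec n w = subst_mpoly (\<lambda>_. 1) (schubert n w)"

definition count_132 :: "nat \<Rightarrow> (nat \<Rightarrow> nat) \<Rightarrow> nat" where
  "count_132 n w = card {(i, j, k). 1 \<le> i \<and> i < j \<and> j < k \<and> k \<le> n \<and> w i < w k \<and> w k < w j}"


subsection \<open>Substitution is a ring homomorphism\<close>

lemma subst_mpoly_superset:
  assumes "finite A" "Poly_Mapping.keys f \<subseteq> A"
  shows "subst_mpoly \<sigma> f = (\<Sum>m\<in>A. of_int (Poly_Mapping.lookup f m) *
        (\<Prod>v\<in>Poly_Mapping.keys m. \<sigma> v ^ Poly_Mapping.lookup m v))"
  unfolding subst_mpoly_def using assms
  by (intro sum.mono_neutral_left) (auto simp: in_keys_iff)

lemma monom_superset:
  fixes \<sigma> :: "nat \<Rightarrow> 'a::comm_ring_1"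
  assumes "finite A" "Poly_Mapping.keys m \<subseteq> A"
  shows "(\<Prod>v\<in>Poly_Mapping.keys m. \<sigma> v ^ Poly_Mapping.lookup m v) =
         (\<Prod>v\<in>A. \<sigma> v ^ Poly_Mapping.lookup m v)"
  using assms by (intro prod.mono_neutral_left) (auto simp: in_keys_iff)

lemma monom_add:
  fixes \<sigma> :: "nat \<Rightarrow> 'a::comm_ring_1"
  shows "(\<Prod>v\<in>Poly_Mapping.keys (a + b). \<sigma> v ^ Poly_Mapping.lookup (a + b) v) =
     (\<Prod>v\<in>Poly_Mapping.keys a. \<sigma> v ^ Poly_Mapping.lookup a v) *
     (\<Prod>v\<in>Poly_Mapping.keys b. \<sigma> v ^ Poly_Mapping.lookup b v)"
proof -
  let ?A = "Poly_Mapping.keys a \<union> Poly_Mapping.keys b"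
  have "finite ?A" "Poly_Mapping.keys (a + b) \<subseteq> ?A" by (auto dest: subsetD[OF Poly_Mapping.keys_add])
  then have "(\<Prod>v\<in>Poly_Mapping.keys (a + b). \<sigma> v ^ Poly_Mapping.lookup (a + b) v) =
        (\<Prod>v\<in>?A. \<sigma> v ^ Poly_Mapping.lookup (a + b) v)"
    by (rule monom_superset)
  also have "\<dots> = (\<Prod>v\<in>?A. \<sigma> v ^ Poly_Mapping.lookup a v) * (\<Prod>v\<in>?A. \<sigma> v ^ Poly_Mapping.lookup b v)"
    by (simp add: lookup_add power_add prod.distrib)
  finally show ?thesis
    by (simp add: monom_superset[of ?A a \<sigma>] monom_superset[of ?A b \<sigma>])
qed

lemma subst_mpoly_0 [simp]: "subst_mpoly \<sigma> 0 = 0"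
  by (simp add: subst_mpoly_def)

lemma subst_mpoly_single:
  "subst_mpoly \<sigma> (Poly_Mapping.single m c) =
     of_int c * (\<Prod>v\<in>Poly_Mapping.keys m. \<sigma> v ^ Poly_Mapping.lookup m v)"
  by (subst subst_mpoly_superset[of "{m}"]) auto

lemma subst_mpoly_1 [simp]: "subst_mpoly \<sigma> 1 = 1"
  using subst_mpoly_single[of \<sigma> 0 1] by simp

lemma subst_mpoly_add: "subst_mpoly \<sigma> (f + g) = subst_mpoly \<sigma> f + subst_mpoly \<sigma> g"
proof -
  let ?A = "Poly_Mapping.keys f \<union> Poly_Mapping.keys g"
  have "Poly_Mapping.keys (f + g) \<subseteq> ?A" by (rule Poly_Mapping.keys_add)
  then show ?thesis
    by (simp add: subst_mpoly_superset[of ?A f] subst_mpoly_superset[of ?A g]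
        subst_mpoly_superset[of ?A "f + g"] lookup_add ring_distribs sum.distrib)
qed

lemma subst_mpoly_uminus: "subst_mpoly \<sigma> (- f) = - subst_mpoly \<sigma> f"
  using subst_mpoly_add[of \<sigma> f "- f"] by (simp add: eq_neg_iff_add_eq_0 add.commute)

lemma subst_mpoly_diff: "subst_mpoly \<sigma> (f - g) = subst_mpoly \<sigma> f - subst_mpoly \<sigma> g"
  using subst_mpoly_add[of \<sigma> f "- g"] by (simp add: subst_mpoly_uminus)

lemma subst_mpoly_sum: "subst_mpoly \<sigma> (\<Sum>a\<in>A. f a) = (\<Sum>a\<in>A. subst_mpoly \<sigma> (f a))"
  by (induction A rule: infinite_finite_induct) (auto simp: subst_mpoly_add)

lemma mpoly_sum_single:
  "f = (\<Sum>m\<in>Poly_Mapping.keys f. Poly_Mapping.single m (Poly_Mapping.lookup f m))"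
  by (rule poly_mapping_eqI)
     (auto simp: lookup_sum lookup_single when_def in_keys_iff sum.delta' sum.delta)

lemma subst_mpoly_mult: "subst_mpoly \<sigma> (f * g) = subst_mpoly \<sigma> f * subst_mpoly \<sigma> g"
proof -
  have "f * g = (\<Sum>a\<in>Poly_Mapping.keys f. \<Sum>b\<in>Poly_Mapping.keys g.
      Poly_Mapping.single (a + b) (Poly_Mapping.lookup f a * Poly_Mapping.lookup g b))"
    by (subst (1) mpoly_sum_single[of f], subst (1) mpoly_sum_single[of g])
       (simp add: sum_product mult_single)
  then have "subst_mpoly \<sigma> (f * g) = (\<Sum>a\<in>Poly_Mapping.keys f. \<Sum>b\<in>Poly_Mapping.keys g.
      subst_mpoly \<sigma> (Poly_Mapping.single (a + b) (Poly_Mapping.lookup f a * Poly_Mapping.lookup g b)))"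
    by (simp add: subst_mpoly_sum)
  also have "\<dots> = subst_mpoly \<sigma> f * subst_mpoly \<sigma> g"
    unfolding subst_mpoly_def[of \<sigma> f] subst_mpoly_def[of \<sigma> g] sum_product
    by (intro sum.cong refl) (simp add: subst_mpoly_single monom_add algebra_simps)
  finally show ?thesis .
qed

lemma subst_mpoly_var [simp]: "subst_mpoly \<sigma> (var i) = \<sigma> i"
  by (simp add: var_def subst_mpoly_single)

lemma subst_mpoly_power: "subst_mpoly \<sigma> (f ^ k) = subst_mpoly \<sigma> f ^ k"
  by (induction k) (auto simp: subst_mpoly_mult)

lemma subst_mpoly_prod: "subst_mpoly \<sigma> (\<Prod>a\<in>A. f a) = (\<Prod>a\<in>A. subst_mpoly \<sigma> (f a))"
  by (induction A rule: infinite_finite_induct) (auto simp: subst_mpoly_mult)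

lemma var_power: "var i ^ k = Poly_Mapping.single (Poly_Mapping.single i k) 1"
  by (induction k) (auto simp: var_def mult_single simp flip: single_add)

lemma of_int_mpoly: "(of_int c :: int_mpoly) = Poly_Mapping.single 0 c"
  by (simp flip: single_of_int)

lemma monom_prod_single:
  "(\<Prod>v\<in>A. Poly_Mapping.single (k v) 1 :: int_mpoly) = Poly_Mapping.single (\<Sum>v\<in>A. k v) 1"
  by (induction A rule: infinite_finite_induct) (auto simp: mult_single)

lemma subst_mpoly_id: "subst_mpoly var f = f"
proof -
  have exps: "(\<Sum>v\<in>Poly_Mapping.keys m. Poly_Mapping.single v (Poly_Mapping.lookup m v)) = m"
    for m :: "nat \<Rightarrow>\<^sub>0 nat"
    by (rule poly_mapping_eqI)
       (auto simp: lookup_sum lookup_single when_def in_keys_iff sum.delta' sum.delta)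
  show ?thesis
    unfolding subst_mpoly_def
    by (subst (3) mpoly_sum_single[of f])
       (simp add: var_power of_int_mpoly monom_prod_single mult_single exps)
qed

lemma subst_mpoly_of_int [simp]: "subst_mpoly \<sigma> (of_int c) = of_int c"
  by (simp add: of_int_mpoly subst_mpoly_single)

lemma mpoly_induct [case_names of_int var add mult]:
  assumes "\<And>c. P (of_int c)" "\<And>i. P (var i)"
    "\<And>f g. P f \<Longrightarrow> P g \<Longrightarrow> P (f + g)" "\<And>f g. P f \<Longrightarrow> P g \<Longrightarrow> P (f * g)"
  shows "P f"
proof -
  have one: "P 1" and zero: "P 0" using assms(1)[of 1] assms(1)[of 0] by auto
  have pow: "P (var i ^ k)" for i k by (induction k) (auto intro: assms one)
  have prod: "P (\<Prod>v\<in>A. var v ^ k v)" for A k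
    by (induction A rule: infinite_finite_induct) (auto intro: assms one pow)
  have sum: "(\<And>a. P (h a)) \<Longrightarrow> P (\<Sum>a\<in>A. h a)" for h and A :: "(nat \<Rightarrow>\<^sub>0 nat) set"
    by (induction A rule: infinite_finite_induct) (auto intro: assms zero)
  have "P (subst_mpoly var f)"
    unfolding subst_mpoly_def by (intro sum assms(4) assms(1) prod)
  then show ?thesis by (simp add: subst_mpoly_id)
qed

lemma subst_mpoly_subst:
  "subst_mpoly \<sigma> (subst_mpoly \<tau> f) = subst_mpoly (\<lambda>v. subst_mpoly \<sigma> (\<tau> v)) f"
  by (induction f rule: mpoly_induct) (auto simp: subst_mpoly_add subst_mpoly_mult)


subsection \<open>Divided differences\<close>

lemma var_inject: "var i = var j \<longleftrightarrow> i = j"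
proof
  assume "var i = var j"
  then have "subst_mpoly (\<lambda>v. if v = i then 1 else (0::int)) (var i) =
             subst_mpoly (\<lambda>v. if v = i then 1 else (0::int)) (var j)" by simp
  then show "i = j" by (auto split: if_splits)
qed simp

lemma swap_vars_ring [simp]:
  "swap_vars i (f + g) = swap_vars i f + swap_vars i g"
  "swap_vars i (f - g) = swap_vars i f - swap_vars i g"
  "swap_vars i (f * g) = swap_vars i f * swap_vars i g"
  "swap_vars i (of_int c) = of_int c"
  "swap_vars i (var v) = var (transpose i (i + 1) v)"
  by (simp_all add: swap_vars_def subst_mpoly_add subst_mpoly_mult subst_mpoly_diff)

lemma var_diff_dvd: "var i - var (i + 1) dvd f - swap_vars i f"
proof (induction f rule: mpoly_induct)
  case (var v)
  have "var i - var (i + 1) dvd var (i + 1) - var i"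
    using dvd_minus_iff[of "var i - var (i + 1)" "var i - var (i + 1)"] by simp
  then show ?case
    by (auto simp: transpose_def)
next
  case (add f g)
  then have "var i - var (i + 1) dvd (f - swap_vars i f) + (g - swap_vars i g)"
    by (rule dvd_add)
  then show ?case by (simp add: algebra_simps)
next
  case (mult f g)
  then have "var i - var (i + 1) dvd (f - swap_vars i f) * g + swap_vars i f * (g - swap_vars i g)"
    by (intro dvd_add dvd_mult dvd_mult2)
  then show ?case by (simp add: algebra_simps)
qed auto

lemma divided_diff_ex1: "\<exists>!g. (var i - var (i + 1)) * g = f - swap_vars i f"
proof -
  have "var i - var (i + 1) \<noteq> 0" by (simp add: var_inject)
  then show ?thesis using var_diff_dvd[of i f] unfolding dvd_def by (metis mult_left_cancel)
qed

lemma divided_diff: "(var i - var (i + 1)) * divided_diff i f = f - swap_vars i f"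
  unfolding divided_diff_def by (rule theI'[OF divided_diff_ex1])

lemma swap_divided_diff:
  "(var (transpose i (i + 1) j) - var (transpose i (i + 1) (j + 1))) * swap_vars i (divided_diff j f)
     = swap_vars i f - swap_vars i (swap_vars j f)"
  using arg_cong[OF divided_diff[of j f], of "swap_vars i"] by simp

lemma swap_vars_comm:
  assumes "i + 1 < j"
  shows "swap_vars i (swap_vars j f) = swap_vars j (swap_vars i f)"
  using assms by (induction f rule: mpoly_induct) (auto simp: transpose_def)

lemma swap_vars_braid:
  "swap_vars i (swap_vars (i + 1) (swap_vars i f)) =
   swap_vars (i + 1) (swap_vars i (swap_vars (i + 1) f))"
  by (induction f rule: mpoly_induct) (auto simp: transpose_def)

lemma swap_vars_invol [simp]: "swap_vars i (swap_vars i f) = f"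
  by (induction f rule: mpoly_induct) (auto simp: transpose_def)

lemma divided_diff_comm:
  assumes ij: "i + 1 < j"
  shows "divided_diff i (divided_diff j f) = divided_diff j (divided_diff i f)"
proof -
  define di where "di = var i - var (i + 1)"
  define dj where "dj = var j - var (j + 1)"
  have nz: "di \<noteq> 0" "dj \<noteq> 0" by (simp_all add: di_def dj_def var_inject)
  note dd = divided_diff[of i, folded di_def] divided_diff[of j, folded dj_def]
  have sj: "dj * swap_vars i (divided_diff j f) = swap_vars i f - swap_vars i (swap_vars j f)"
    using swap_divided_diff[of i j f] ij by (simp add: dj_def)
  have si: "di * swap_vars j (divided_diff i f) = swap_vars j f - swap_vars j (swap_vars i f)"
    using swap_divided_diff[of j i f] ij by (simp add: di_def)
  have "(di * dj) * divided_diff i (divided_diff j f) =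
        dj * divided_diff j f - dj * swap_vars i (divided_diff j f)"
    using dd(1)[of "divided_diff j f"] by (metis mult.assoc mult.commute right_diff_distrib)
  also have "\<dots> = di * divided_diff i f - di * swap_vars j (divided_diff i f)"
    unfolding si sj dd by (simp add: swap_vars_comm[OF ij])
  also have "\<dots> = (di * dj) * divided_diff j (divided_diff i f)"
    using dd(2)[of "divided_diff i f"] by (metis mult.assoc right_diff_distrib)
  finally show ?thesis using nz by simp
qed

lemma clear_denominator:
  fixes a b c u g h :: "'a::comm_ring_1"
  assumes "a * u = g - h"
  shows "(a * b * c) * u = b * c * g - b * (c * h)"
proof -
  have "(a * b * c) * u = b * c * (a * u)" by (simp only: mult_ac)
  then show ?thesis by (simp only: assms right_diff_distrib mult.assoc)
qed

lemma divided_diff_braid: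
  "divided_diff i (divided_diff (i + 1) (divided_diff i f)) =
   divided_diff (i + 1) (divided_diff i (divided_diff (i + 1) f))"
proof -
  define j where "j = i + 1"
  let ?s = "swap_vars i" and ?t = "swap_vars j"
  let ?D = "divided_diff i" and ?E = "divided_diff j"
  define x where "x = var i"
  define y where "y = var j"
  define z where "z = var (j + 1)"
  have sv: "?s x = y" "?s y = x" "?s z = z" "?t x = x" "?t y = z" "?t z = y"
    by (simp_all add: x_def y_def z_def j_def transpose_def)
  have D: "(x - y) * ?D g = g - ?s g" for g
    using divided_diff[of i g] by (simp add: x_def y_def j_def)
  have E: "(y - z) * ?E g = g - ?t g" for g
    using divided_diff[of j g] by (simp add: z_def y_def)
  have nz: "x - y \<noteq> 0" "y - z \<noteq> 0" "x - z \<noteq> 0"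
    by (simp_all add: x_def y_def z_def j_def var_inject)
  have tD: "(x - z) * ?t (?D g) = ?t g - ?t (?s g)" for g
    using arg_cong[OF D[of g], of ?t] by (simp add: sv)
  have stD: "(y - z) * ?s (?t (?D g)) = ?s (?t g) - ?s (?t (?s g))" for g
    using arg_cong[OF tD[of g], of ?s] by (simp add: sv)
  have sE: "(x - z) * ?s (?E g) = ?s g - ?s (?t g)" for g
    using arg_cong[OF E[of g], of ?s] by (simp add: sv)
  have tsE: "(x - y) * ?t (?s (?E g)) = ?t (?s g) - ?t (?s (?t g))" for g
    using arg_cong[OF sE[of g], of ?t] by (simp add: sv)
  have sD: "?s (?D g) = ?D g" for g
  proof -
    have "(y - x) * ?s (?D g) = ?s g - g" using arg_cong[OF D[of g], of ?s] by (simp add: sv)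
    then have "(x - y) * ?s (?D g) = (x - y) * ?D g" using D[of g]
      by (metis minus_diff_eq mult_minus_left)
    then show ?thesis using nz by simp
  qed
  have tE: "?t (?E g) = ?E g" for g
  proof -
    have "(z - y) * ?t (?E g) = ?t g - g" using arg_cong[OF E[of g], of ?t] by (simp add: sv)
    then have "(y - z) * ?t (?E g) = (y - z) * ?E g" using E[of g]
      by (metis minus_diff_eq mult_minus_left)
    then show ?thesis using nz by simp
  qed
  let ?alt = "f - ?s f - ?t f + ?s (?t f) + ?t (?s f) - ?s (?t (?s f))"
  have "((x - y) * (y - z) * (x - z)) * ?D (?E (?D f)) =
        (y - z) * (x - z) * ?E (?D f) - (y - z) * ((x - z) * ?s (?E (?D f)))"
    by (rule clear_denominator[OF D])
  also have "\<dots> = (x - z) * (?D f - ?t (?D f)) - (y - z) * (?D f - ?s (?t (?D f)))"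
    unfolding sE sD E[symmetric] by (simp only: mult_ac)
  also have "\<dots> = (x - y) * ?D f - (x - z) * ?t (?D f) + (y - z) * ?s (?t (?D f))"
    by (simp add: algebra_simps)
  also have "\<dots> = ?alt"
    unfolding D tD stD by simp
  finally have 1: "((x - y) * (y - z) * (x - z)) * ?D (?E (?D f)) = ?alt" .
  have "((x - y) * (y - z) * (x - z)) * ?E (?D (?E f)) =
        (x - y) * (x - z) * ?D (?E f) - (x - y) * ((x - z) * ?t (?D (?E f)))"
    using clear_denominator[OF E, of "x - y" "x - z" "?D (?E f)"]
    by (simp only: mult.commute[of "y - z" "x - y"])
  also have "\<dots> = (x - z) * (?E f - ?s (?E f)) - (x - y) * (?E f - ?t (?s (?E f)))"
    unfolding tD tE D[symmetric] by (simp only: mult_ac)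
  also have "\<dots> = (y - z) * ?E f - (x - z) * ?s (?E f) + (x - y) * ?t (?s (?E f))"
    by (simp add: algebra_simps)
  also have "\<dots> = ?alt"
    unfolding E sE tsE using swap_vars_braid[of i f, folded j_def] by simp
  finally have 2: "((x - y) * (y - z) * (x - z)) * ?E (?D (?E f)) = ?alt" .
  from 1 2 have "((x - y) * (y - z) * (x - z)) * ?D (?E (?D f)) =
                 ((x - y) * (y - z) * (x - z)) * ?E (?D (?E f))" by simp
  then show ?thesis unfolding j_def[symmetric] using nz by simp
qed


subsection \<open>Schubert polynomials are well defined\<close>

definition perm_weight :: "nat \<Rightarrow> (nat \<Rightarrow> nat) \<Rightarrow> nat" where
  "perm_weight n w = (\<Sum>i\<in>{1..n}. i * w i)"

lemma permutes_swap:
  fixes n :: nat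
  assumes "w permutes {1..n}" "1 \<le> i" "i < n"
  shows "(w \<circ> transpose i (i + 1)) permutes {1..n}"
  by (rule permutes_compose[OF permutes_swap_id assms(1)]) (use assms in auto)

lemma perm_weight_swap:
  assumes "1 \<le> i" "i < n" "w i < w (i + 1)"
  shows "perm_weight n (w \<circ> transpose i (i + 1)) < perm_weight n w"
proof -
  let ?A = "{1..n} - {i, i + 1}"
  have split: "perm_weight n v = i * v i + (i + 1) * v (i + 1) + (\<Sum>k\<in>?A. k * v k)" for v
  proof -
    have "{1..n} = insert i (insert (i + 1) ?A)" using assms by auto
    then have "perm_weight n v = (\<Sum>k\<in>insert i (insert (i + 1) ?A). k * v k)"
      unfolding perm_weight_def by simp
    then show ?thesis by simp
  qed
  have "(\<Sum>k\<in>?A. k * (w \<circ> transpose i (i + 1)) k) = (\<Sum>k\<in>?A. k * w k)"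
    by (intro sum.cong) (auto simp: transpose_def)
  then show ?thesis using assms by (simp add: split)
qed

lemma no_ascent_longest:
  assumes w: "w permutes {1..n}" and no: "\<And>i. 1 \<le> i \<Longrightarrow> i < n \<Longrightarrow> \<not> w i < w (i + 1)"
  shows "w = longest_perm n"
proof
  fix k
  have desc: "w (i + 1) < w i" if "1 \<le> i" "i < n" for i
    using no[OF that] permutes_inj[OF w] by (metis add_cancel_right_right inj_eq linorder_neqE_nat zero_neq_one)
  have mono: "w j + j \<le> w i + i" if "1 \<le> i" "i \<le> j" "j \<le> n" for i j
    using that(2,3)
  proof (induction j rule: dec_induct)
    case (step m)
    then show ?case using desc[of m] that(1) by auto
  qed simp
  have range: "w i \<in> {1..n}" if "i \<in> {1..n}" for i
    using permutes_in_image[OF w] that by blast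
  show "w k = longest_perm n k"
  proof (cases "k \<in> {1..n}")
    case True
    then have "w k + k \<le> w 1 + 1" "w n + n \<le> w k + k" using mono[of 1 k] mono[of k n] by auto
    moreover have "w 1 \<le> n" "1 \<le> w n" using range[of 1] range[of n] True by auto
    ultimately show ?thesis using True by (auto simp: longest_perm_def)
  next
    case False
    then show ?thesis using permutes_not_in[OF w False] by (auto simp: longest_perm_def)
  qed
qed

lemma longest_no_ascent:
  "1 \<le> i \<Longrightarrow> i < n \<Longrightarrow> \<not> longest_perm n i < longest_perm n (i + 1)"
  by (auto simp: longest_perm_def)

lemma is_schubert_ex:
  assumes "w permutes {1..n}"
  shows "\<exists>f. is_schubert n w f"
  using assms
proof (induction "perm_weight n w" arbitrary: w rule: less_induct)
  case less
  show ?case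
  proof (cases "\<exists>i. 1 \<le> i \<and> i < n \<and> w i < w (i + 1)")
    case True
    then obtain i where i: "1 \<le> i" "i < n" "w i < w (i + 1)" by blast
    then obtain f where "is_schubert n (w \<circ> transpose i (i + 1)) f"
      using less.hyps[OF perm_weight_swap permutes_swap] less.prems by blast
    then show ?thesis using is_schubert.step[OF less.prems i] by blast
  next
    case False
    then have "w = longest_perm n" using no_ascent_longest[OF less.prems] by blast
    then show ?thesis using is_schubert.longest by blast
  qed
qed

lemma is_schubert_step_unique:
  assumes w: "w permutes {1..n}"
    and IH: "\<And>v f g. perm_weight n v < perm_weight n w \<Longrightarrow> v permutes {1..n} \<Longrightarrow>
               is_schubert n v f \<Longrightarrow> is_schubert n v g \<Longrightarrow> f = g"
    and i: "1 \<le> i" "i < n" "w i < w (i + 1)" and f: "is_schubert n (w \<circ> transpose i (i + 1)) f"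
    and j: "1 \<le> j" "j < n" "w j < w (j + 1)" and g: "is_schubert n (w \<circ> transpose j (j + 1)) g"
    and ij: "i < j"
  shows "divided_diff i f = divided_diff j g"
proof -
  let ?si = "transpose i (i + 1)" and ?sj = "transpose j (j + 1)"
  note pi = permutes_swap[OF w i(1,2)] and pj = permutes_swap[OF w j(1,2)]
  note wi = perm_weight_swap[of i n w, OF i] and wj = perm_weight_swap[of j n w, OF j]
  show ?thesis
  proof (cases "j = i + 1")
    case False
    with ij have ij: "i + 1 < j" by simp
    have eq: "w \<circ> ?si \<circ> ?sj = w \<circ> ?sj \<circ> ?si"
      using ij by (auto simp: fun_eq_iff transpose_def)
    have pij: "(w \<circ> ?si \<circ> ?sj) permutes {1..n}" by (rule permutes_swap[OF pi j(1,2)])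
    obtain h where h: "is_schubert n (w \<circ> ?si \<circ> ?sj) h" using is_schubert_ex[OF pij] by blast
    have "is_schubert n (w \<circ> ?si) (divided_diff j h)"
      by (rule is_schubert.step[OF pi j(1,2) _ h]) (use ij j in \<open>simp add: transpose_def\<close>)
    then have "f = divided_diff j h" using IH[OF wi pi f] by blast
    moreover have "is_schubert n (w \<circ> ?sj) (divided_diff i h)"
      by (rule is_schubert.step[OF pj i(1,2) _ h[unfolded eq]]) (use ij i in \<open>simp add: transpose_def\<close>)
    then have "g = divided_diff i h" using IH[OF wj pj g] by blast
    ultimately show ?thesis using divided_diff_comm[OF ij] by simp
  next
    case True
    have eq: "w \<circ> ?si \<circ> ?sj \<circ> ?si = w \<circ> ?sj \<circ> ?si \<circ> ?sj"
      using True by (auto simp: fun_eq_iff transpose_def)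
    have pij: "(w \<circ> ?si \<circ> ?sj) permutes {1..n}" by (rule permutes_swap[OF pi j(1,2)])
    have pji: "(w \<circ> ?sj \<circ> ?si) permutes {1..n}" by (rule permutes_swap[OF pj i(1,2)])
    obtain h where h: "is_schubert n (w \<circ> ?si \<circ> ?sj \<circ> ?si) h"
      using is_schubert_ex[OF permutes_swap[OF pij i(1,2)]] by blast
    have "is_schubert n (w \<circ> ?si \<circ> ?sj) (divided_diff i h)"
      by (rule is_schubert.step[OF pij i(1,2) _ h]) (use True i j in \<open>simp add: transpose_def\<close>)
    then have "is_schubert n (w \<circ> ?si) (divided_diff j (divided_diff i h))"
      by (rule is_schubert.step[OF pi j(1,2), rotated]) (use True i j in \<open>simp add: transpose_def\<close>)
    then have "f = divided_diff j (divided_diff i h)" using IH[OF wi pi f] by blast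
    moreover have "is_schubert n (w \<circ> ?sj \<circ> ?si) (divided_diff j h)"
      by (rule is_schubert.step[OF pji j(1,2) _ h[unfolded eq]])
         (use True i j in \<open>simp add: transpose_def\<close>)
    then have "is_schubert n (w \<circ> ?sj) (divided_diff i (divided_diff j h))"
      by (rule is_schubert.step[OF pj i(1,2), rotated]) (use True i j in \<open>simp add: transpose_def\<close>)
    then have "g = divided_diff i (divided_diff j h)" using IH[OF wj pj g] by blast
    ultimately show ?thesis using divided_diff_braid[of i h] True by simp
  qed
qed

lemma is_schubert_unique:
  assumes "w permutes {1..n}" "is_schubert n w f" "is_schubert n w g"
  shows "f = g"
  using assms
proof (induction "perm_weight n w" arbitrary: w f g rule: less_induct)
  case less
  note w = less.prems(1)
  have IH: "f' = g'" if "perm_weight n v < perm_weight n w" "v permutes {1..n}"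
    "is_schubert n v f'" "is_schubert n v g'" for v f' g'
    using less.hyps[OF that(1)] that(2-) by blast
  show ?case using less.prems(2)
  proof cases
    case longest
    note f = this
    show ?thesis using less.prems(3)
    proof cases
      case (step j g')
      then show ?thesis using f longest_no_ascent[of j n] by blast
    qed (use f in simp)
  next
    case (step i f')
    note f = this
    show ?thesis using less.prems(3)
    proof cases
      case longest
      then show ?thesis using f longest_no_ascent[of i n] by blast
    next
      case (step j g')
      consider "i = j" | "i < j" | "j < i" by linarith
      then show ?thesis
      proof cases
        case 1
        then show ?thesis
          using IH[OF perm_weight_swap[OF f(3-5)] permutes_swap[OF w f(3,4)] f(6)] step f by blast
      next
        case 2
        have "divided_diff i f' = divided_diff j g'"
          by (rule is_schubert_step_unique[OF w _ f(3-6) step(3-6) 2]) (rule IH)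
        then show ?thesis using f(1) step(1) by simp
      next
        case 3
        have "divided_diff j g' = divided_diff i f'"
          by (rule is_schubert_step_unique[OF w _ step(3-6) f(3-6) 3]) (rule IH)
        then show ?thesis using f(1) step(1) by simp
      qed
    qed
  qed
qed

theorem is_schubert_ex1: "w permutes {1..n} \<Longrightarrow> \<exists>!f. is_schubert n w f"
  using is_schubert_ex is_schubert_unique by blast

end

theory Submission
  imports Defs
begin

text \<open>
  Let \<open>r\<close> be the last descent of \<open>w\<close>, let \<open>s\<close> be the last position after \<open>r\<close> with \<open>w s < w r\<close>, and
  let \<open>v\<close> be \<open>w\<close> with the values at \<open>r\<close> and \<open>s\<close> exchanged. The only upward Bruhat cover of \<open>v\<close>
  that exchanges \<open>r\<close> with a later position is \<open>w\<close>, so Monk's rule for multiplication by \<open>x\<^sub>r\<close>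
  becomes Lascoux's transition: \<open>\<nu>\<close> of \<open>w\<close> is \<open>\<nu>\<close> of \<open>v\<close> plus the sum of the \<open>\<nu>\<close> of the covers
  \<open>v t\<^sub>q\<^sub>r\<close> with \<open>q < r\<close>. Passing from \<open>w\<close> to \<open>v\<close> loses one 132-pattern \<open>(i, r, s)\<close> for every
  \<open>i < r\<close> with \<open>w i < w s\<close>. Each such \<open>i\<close> is either itself one of the \<open>q\<close>, or lies to the left of
  and below some \<open>q\<close> and then yields the pattern \<open>(i, q, r)\<close> of \<open>v t\<^sub>q\<^sub>r\<close>; so the lost patterns are
  paid for by the inductive lower bounds for the covers. The induction is lexicographic in
  \<open>(r, w r)\<close>.

  Monk's rule is propagated by divided differences from the longest permutation of \<open>S\<^sub>n\<close>, where it
  leaves \<open>S\<^sub>n\<close>; both that base case and the stability of Schubert polynomials under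
  \<open>S\<^sub>n \<subseteq> S\<^sub>n\<^sub>+\<^sub>1\<close> hold because the Schubert polynomial of a 132-avoiding permutation is the
  monomial of its Lehmer code.
\<close>

section \<open>Divided differences of Schubert polynomials\<close>

lemma longest_perm_permutes: "longest_perm n permutes {1..n}"
proof -
  have inv: "longest_perm n (longest_perm n i) = i" for i
    by (auto simp: longest_perm_def)
  show ?thesis
    unfolding permutes_def
    by (metis inv longest_perm_def)
qed

lemma is_schubert_schubert: "w permutes {1..n} \<Longrightarrow> is_schubert n w (schubert n w)"
  unfolding schubert_def by (rule theI'[OF is_schubert_ex1])

lemma schubert_eqI: "w permutes {1..n} \<Longrightarrow> is_schubert n w f \<Longrightarrow> schubert n w = f"
  using is_schubert_schubert is_schubert_unique by blast

lemma schubert_ascent: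
  assumes "w permutes {1..n}" "1 \<le> i" "i < n" "w i < w (i + 1)"
  shows "schubert n w = divided_diff i (schubert n (w \<circ> transpose i (i + 1)))"
  by (intro schubert_eqI is_schubert.step is_schubert_schubert permutes_swap assms)

lemma divided_diff_eqI:
  "(var i - var (i + 1)) * g = f - swap_vars i f \<Longrightarrow> divided_diff i f = g"
  using divided_diff_ex1 divided_diff by blast

lemma divided_diff_0 [simp]: "divided_diff i 0 = 0"
  by (rule divided_diff_eqI) (simp add: swap_vars_def)

lemma divided_diff_add: "divided_diff i (f + g) = divided_diff i f + divided_diff i g"
  by (rule divided_diff_eqI) (simp only: distrib_left divided_diff swap_vars_ring add_diff_eq diff_add_eq diff_diff_eq)

lemma divided_diff_sum: "divided_diff i (\<Sum>a\<in>A. f a) = (\<Sum>a\<in>A. divided_diff i (f a))"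
  by (induction A rule: infinite_finite_induct) (auto simp: divided_diff_add)

lemma divided_diff_of_int_mult: "divided_diff i (of_int c * f) = of_int c * divided_diff i f"
proof (rule divided_diff_eqI)
  have "(var i - var (i + 1)) * (of_int c * divided_diff i f) =
      of_int c * ((var i - var (i + 1)) * divided_diff i f)"
    by (simp only: mult_ac)
  then show "(var i - var (i + 1)) * (of_int c * divided_diff i f) =
      of_int c * f - swap_vars i (of_int c * f)"
    by (simp only: divided_diff swap_vars_ring right_diff_distrib)
qed

lemma swap_vars_divided_diff: "swap_vars i (divided_diff i f) = divided_diff i f"
proof -
  have "(var (i + 1) - var i) * swap_vars i (divided_diff i f) = swap_vars i f - f"
    using swap_divided_diff[of i i f] by simp
  then have "(var i - var (i + 1)) * swap_vars i (divided_diff i f) = f - swap_vars i f"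
    by (metis minus_diff_eq mult_minus_left)
  then show ?thesis by (metis divided_diff_eqI)
qed

lemma divided_diff_twice: "divided_diff i (divided_diff i f) = 0"
  by (rule divided_diff_eqI) (simp add: swap_vars_divided_diff)

text \<open>Twisted Leibniz rule; the integer coefficient is the divided difference of
  \<open>var r\<close> itself.\<close>

lemma divided_diff_var_mult:
  "divided_diff i (var r * f) = var (transpose i (i + 1) r) * divided_diff i f +
     of_int ((if r = i then 1 else 0) - (if r = i + 1 then 1 else 0)) * f"
proof (rule divided_diff_eqI)
  let ?t = "transpose i (i + 1) r" and ?e = "(if r = i then 1 else 0) - (if r = i + 1 then 1 else 0)"
  have "(var i - var (i + 1)) * (var ?t * divided_diff i f + of_int ?e * f) =
      var ?t * (f - swap_vars i f) + (var i - var (i + 1)) * of_int ?e * f"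
    unfolding divided_diff[symmetric] by (simp only: distrib_left mult_ac)
  also have "(var i - var (i + 1)) * of_int ?e = var r - var ?t"
    by (auto simp: transpose_def)
  also have "var ?t * (f - swap_vars i f) + (var r - var ?t) * f =
      var r * f - swap_vars i (var r * f)"
    by (simp add: algebra_simps)
  finally show "(var i - var (i + 1)) * (var ?t * divided_diff i f + of_int ?e * f) =
      var r * f - swap_vars i (var r * f)" .
qed

text \<open>At a descent this is the defining recursion read backwards; at an ascent
  \<open>schubert n w\<close> is itself a value of \<open>divided_diff i\<close>, and the operator
  squares to zero.\<close>

lemma divided_diff_schubert:
  assumes "w permutes {1..n}" "1 \<le> i" "i < n"
  shows "divided_diff i (schubert n w) =
    (if w (i + 1) < w i then schubert n (w \<circ> transpose i (i + 1)) else 0)"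
proof (cases "w (i + 1) < w i")
  case True
  have "w \<circ> transpose i (i + 1) \<circ> transpose i (i + 1) = w" by (simp add: fun_eq_iff)
  then show ?thesis
    using schubert_ascent[OF permutes_swap[OF assms], of i] assms True by simp
next
  case False
  moreover have "w i \<noteq> w (i + 1)" using permutes_inj[OF assms(1)] by (simp add: inj_eq)
  ultimately show ?thesis
    using schubert_ascent[OF assms] by (simp add: divided_diff_twice)
qed


subsection \<open>Dominant permutations and stability\<close>

definition avoids_132 :: "nat \<Rightarrow> (nat \<Rightarrow> nat) \<Rightarrow> bool" where
  "avoids_132 n w \<longleftrightarrow> (\<forall>i j k. 1 \<le> i \<and> i < j \<and> j < k \<and> k \<le> n \<longrightarrow> \<not> (w i < w k \<and> w k < w j))"

definition lehmer_code :: "nat \<Rightarrow> (nat \<Rightarrow> nat) \<Rightarrow> nat \<Rightarrow> nat" where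
  "lehmer_code n w i = card {j. i < j \<and> j \<le> n \<and> w j < w i}"

text \<open>The exchange creates one inversion, the pair \<open>(i, i + 1)\<close>, counted at
  \<open>i\<close>; the other contributions of the two values travel with them.\<close>

lemma lehmer_code_swap:
  assumes i: "1 \<le> i" "i < n" "w i < w (i + 1)"
  defines "v \<equiv> w \<circ> transpose i (i + 1)"
  shows "lehmer_code n v i = lehmer_code n w (i + 1) + 1"
    and "lehmer_code n v (i + 1) = lehmer_code n w i"
    and "k \<noteq> i \<Longrightarrow> k \<noteq> i + 1 \<Longrightarrow> lehmer_code n v k = lehmer_code n w k"
proof -
  have "{j. i < j \<and> j \<le> n \<and> v j < v i} =
      insert (i + 1) {j. i + 1 < j \<and> j \<le> n \<and> w j < w (i + 1)}"
    using i by (auto simp: v_def transpose_def split: if_splits)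
  then show "lehmer_code n v i = lehmer_code n w (i + 1) + 1"
    by (simp add: lehmer_code_def)
  have "{j. i + 1 < j \<and> j \<le> n \<and> v j < v (i + 1)} = {j. i < j \<and> j \<le> n \<and> w j < w i}"
    using i by (auto simp: v_def transpose_def split: if_splits)
  then show "lehmer_code n v (i + 1) = lehmer_code n w i"
    by (simp add: lehmer_code_def)
next
  assume k: "k \<noteq> i" "k \<noteq> i + 1"
  have "bij_betw (transpose i (i + 1)) {j. k < j \<and> j \<le> n \<and> v j < v k}
      {j. k < j \<and> j \<le> n \<and> w j < w k}"
    by (rule bij_betw_byWitness[where f' = "transpose i (i + 1)"])
       (use i k in \<open>auto simp: v_def transpose_def split: if_splits\<close>)
  then show "lehmer_code n v k = lehmer_code n w k"
    unfolding lehmer_code_def by (rule bij_betw_same_card)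
qed

lemma swap_vars_monomial:
  assumes "1 \<le> i" "i < n" "c i = c (i + 1)"
  shows "swap_vars i (\<Prod>k\<in>{1..n}. var k ^ c k) = (\<Prod>k\<in>{1..n}. var k ^ c k)"
proof -
  let ?t = "transpose i (i + 1)"
  have "swap_vars i (\<Prod>k\<in>{1..n}. var k ^ c k) = (\<Prod>k\<in>{1..n}. var (?t k) ^ c k)"
    by (simp add: swap_vars_def subst_mpoly_prod subst_mpoly_power)
  also have "\<dots> = (\<Prod>k\<in>{1..n}. var (?t k) ^ c (?t k))"
    by (rule prod.cong) (use assms in \<open>auto simp: transpose_def\<close>)
  also have "\<dots> = (\<Prod>k\<in>{1..n}. var k ^ c k)"
    using permutes_swap_id[of i "{1..n}" "i + 1"] assms
    by (intro prod.reindex_bij_betw permutes_imp_bij) auto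
  finally show ?thesis .
qed

text \<open>
  At the first ascent \<open>i\<close> of a 132-avoiding \<open>w\<close> the code entries at \<open>i\<close> and \<open>i + 1\<close> agree, and
  exchanging the two values keeps \<open>w\<close> 132-avoiding and raises the entry at \<open>i\<close> by one.
\<close>

lemma schubert_dominant:
  assumes "w permutes {1..n}" "avoids_132 n w"
  shows "schubert n w = (\<Prod>k\<in>{1..n}. var k ^ lehmer_code n w k)"
  using assms
proof (induction "perm_weight n w" arbitrary: w rule: less_induct)
  case less
  note w = less.prems(1) and av = less.prems(2)
  show ?case
  proof (cases "\<exists>i. 1 \<le> i \<and> i < n \<and> w i < w (i + 1)")
    case False
    then have wl: "w = longest_perm n" using no_ascent_longest[OF w] by blast
    have "lehmer_code n w k = n - k" if "k \<in> {1..n}" for k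
    proof -
      have "{j. k < j \<and> j \<le> n \<and> w j < w k} = {k<..n}"
        using that by (auto simp: wl longest_perm_def)
      then show ?thesis by (simp add: lehmer_code_def)
    qed
    then have "(\<Prod>k\<in>{1..n}. var k ^ lehmer_code n w k) = (\<Prod>k\<in>{1..n}. var k ^ (n - k))"
      by (intro prod.cong) auto
    then show ?thesis
      using schubert_eqI[OF w] is_schubert.longest by (simp add: wl)
  next
    case True
    \<comment> \<open>The first ascent is taken so that \<open>w i\<close> is at most every earlier
      value.\<close>
    define i where "i = (LEAST i. 1 \<le> i \<and> i < n \<and> w i < w (i + 1))"
    have i: "1 \<le> i" "i < n" "w i < w (i + 1)"
      using LeastI_ex[OF True] by (auto simp: i_def)
    have desc: "w (h + 1) \<le> w h" if "1 \<le> h" "h < i" for h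
      using not_less_Least[of h "\<lambda>i. 1 \<le> i \<and> i < n \<and> w i < w (i + 1)"] that i
      unfolding i_def[symmetric] by linarith
    have mono: "w j \<le> w h" if "h \<le> j" "1 \<le> h" "j \<le> i" for h j
      using that
    proof (induction j rule: dec_induct)
      case (step m)
      then show ?case using desc[of m] by force
    qed simp
    define v where "v = w \<circ> transpose i (i + 1)"
    have v: "v permutes {1..n}" unfolding v_def by (rule permutes_swap[OF w i(1,2)])
    have "avoids_132 n v"
      unfolding avoids_132_def
    proof (intro allI impI notI)
      fix a b c assume abc: "1 \<le> a \<and> a < b \<and> b < c \<and> c \<le> n" "v a < v c \<and> v c < v b"
      let ?t = "transpose i (i + 1)"
      show False
      \<comment> \<open>Outside these two cases \<open>?t\<close> keeps the order of
        \<open>a\<close>, \<open>b\<close>, \<open>c\<close> and yields a pattern of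
        \<open>w\<close>. The first case contradicts the descent of \<open>v\<close> at
        \<open>i\<close>, the second would put a value below \<open>w i\<close> before
        \<open>i\<close>.\<close>
      proof (cases "(a = i \<and> b = i + 1) \<or> (b = i \<and> c = i + 1)")
        case True
        then show False
          using abc i mono[of a i] by (auto simp: v_def transpose_def split: if_splits)
      next
        case False
        then have "1 \<le> ?t a \<and> ?t a < ?t b \<and> ?t b < ?t c \<and> ?t c \<le> n"
          using abc i by (auto simp: transpose_def)
        then show False
          using abc av unfolding avoids_132_def v_def by (metis comp_apply)
      qed
    qed
    then have IH: "schubert n v = (\<Prod>k\<in>{1..n}. var k ^ lehmer_code n v k)"
      using less.hyps[OF _ v] perm_weight_swap[OF i] by (simp add: v_def)
    note code = lehmer_code_swap[OF i, folded v_def]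
    \<comment> \<open>A later value strictly between \<open>w i\<close> and \<open>w (i + 1)\<close>
      would complete a 132-pattern with them.\<close>
    have "{j. i < j \<and> j \<le> n \<and> w j < w i} = {j. i + 1 < j \<and> j \<le> n \<and> w j < w (i + 1)}"
    proof (intro Collect_cong iffI)
      fix j assume j: "i + 1 < j \<and> j \<le> n \<and> w j < w (i + 1)"
      then have "\<not> (w i < w j \<and> w j < w (i + 1))"
        using av i unfolding avoids_132_def by (metis less_add_one)
      moreover have "w i \<noteq> w j" using permutes_inj[OF w] j by (auto simp: inj_eq)
      ultimately show "i < j \<and> j \<le> n \<and> w j < w i" using j by auto
    next
      fix j assume j: "i < j \<and> j \<le> n \<and> w j < w i"
      then have "j \<noteq> i + 1" using i by auto
      then show "i + 1 < j \<and> j \<le> n \<and> w j < w (i + 1)" using i j by auto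
    qed
    then have eq: "lehmer_code n w i = lehmer_code n w (i + 1)" by (simp add: lehmer_code_def)
    define m where "m = (\<Prod>k\<in>{1..n}. var k ^ lehmer_code n w k)"
    have "lehmer_code n v k = lehmer_code n w k + (if k = i then 1 else 0)" for k
      using code eq by (cases "k = i \<or> k = i + 1") auto
    then have "schubert n v = (\<Prod>k\<in>{1..n}. var k ^ lehmer_code n w k * var k ^ (if k = i then 1 else 0))"
      unfolding IH by (simp add: power_add)
    also have "\<dots> = m * (\<Prod>k\<in>{1..n}. if k = i then var k else 1)"
      unfolding m_def prod.distrib[symmetric] by (rule prod.cong) auto
    also have "\<dots> = var i * m"
      using i by (simp add: prod.delta mult.commute)
    finally have Sv: "schubert n v = var i * m" .
    have sm: "swap_vars i m = m" unfolding m_def by (rule swap_vars_monomial[OF i(1,2) eq])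
    have "divided_diff i (var i * m) = m"
      by (rule divided_diff_eqI) (simp add: sm algebra_simps)
    then show ?thesis
      using schubert_ascent[OF w i] Sv by (simp add: v_def m_def)
  qed
qed

lemma schubert_id: "schubert n id = 1"
proof -
  have "{j. i < j \<and> j \<le> n \<and> j < i} = {}" for i by auto
  then have "lehmer_code n id i = 0" for i by (simp add: lehmer_code_def)
  moreover have "avoids_132 n id" by (auto simp: avoids_132_def)
  ultimately show ?thesis using schubert_dominant[OF permutes_id, of n] by simp
qed

lemma permutes_Suc:
  fixes n :: nat
  assumes "w permutes {1..n}"
  shows "w permutes {1..n + 1}"
  using assms by (rule permutes_subset) auto

text \<open>Only the base case needs work: in the larger group \<open>longest_perm n\<close> is no
  longer longest but still dominant, with the same code; at \<open>k = n + 1\<close> the truncated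
  \<open>n - k\<close> is 0.\<close>

lemma is_schubert_stable:
  assumes "is_schubert n w f"
  shows "is_schubert (n + 1) w f"
  using assms
proof induction
  case longest
  let ?w = "longest_perm n"
  have p: "?w permutes {1..n + 1}" by (rule permutes_Suc[OF longest_perm_permutes])
  have av: "avoids_132 (n + 1) ?w"
    by (auto simp: avoids_132_def longest_perm_def)
  have code: "lehmer_code (n + 1) ?w k = n - k" if "k \<in> {1..n + 1}" for k
  proof -
    have "{j. k < j \<and> j \<le> n + 1 \<and> ?w j < ?w k} = {k<..n}"
      using that by (auto simp: longest_perm_def)
    then show ?thesis by (simp add: lehmer_code_def)
  qed
  have "schubert (n + 1) ?w = (\<Prod>k\<in>{1..n + 1}. var k ^ (n - k))"
    unfolding schubert_dominant[OF p av] by (intro prod.cong refl) (simp only: code)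
  then show ?case using is_schubert_schubert[OF p] by simp
next
  case (step w i f)
  show ?case
    by (rule is_schubert.step[OF permutes_Suc[OF step.hyps(1)] step.hyps(2) _ step.hyps(4) step.IH])
       (use step.hyps in simp)
qed

lemma schubert_stable: "w permutes {1..n} \<Longrightarrow> schubert (n + 1) w = schubert n w"
  by (intro schubert_eqI permutes_Suc is_schubert_stable is_schubert_schubert)


subsection \<open>Monk's rule\<close>

text \<open>For a permutation this says that exchanging positions \<open>a\<close> and
  \<open>b\<close> raises the number of inversions by exactly one.\<close>

definition bruhat_cover :: "(nat \<Rightarrow> nat) \<Rightarrow> nat \<Rightarrow> nat \<Rightarrow> bool" where
  "bruhat_cover w a b \<longleftrightarrow> a < b \<and> w a < w b \<and> (\<forall>c. a < c \<and> c < b \<longrightarrow> \<not> (w a < w c \<and> w c < w b))"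

text \<open>Multiplication by a single variable gives the signed form of Monk's rule: later
  positions enter with plus, earlier ones with minus.\<close>

definition monk_coeff :: "(nat \<Rightarrow> nat) \<Rightarrow> nat \<Rightarrow> nat \<Rightarrow> int" where
  "monk_coeff w r j = (if bruhat_cover w r j then 1 else if bruhat_cover w j r then -1 else 0)"

text \<open>Conjugation by \<open>t\<close> turns \<open>transpose a b\<close> into
  \<open>transpose (t a) (t b)\<close>, so the lemma decides which covers of \<open>v\<close>
  survive the exchange at the descent \<open>i\<close>.\<close>

lemma bruhat_cover_swap:
  assumes inj: "inj v" and desc: "v (i + 1) < v i" and ne: "{a, b} \<noteq> {i, i + 1}"
  defines "t \<equiv> transpose i (i + 1)"
  shows "bruhat_cover (v \<circ> t) (t a) (t b) \<longleftrightarrow>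
    bruhat_cover v a b \<and> (v \<circ> transpose a b) (i + 1) < (v \<circ> transpose a b) i"
proof -
  have tt: "t (t c) = c" for c by (simp add: t_def)
  have "bruhat_cover (v \<circ> t) (t a) (t b) \<longleftrightarrow>
      t a < t b \<and> v a < v b \<and> (\<forall>c. t a < t c \<and> t c < t b \<longrightarrow> \<not> (v a < v c \<and> v c < v b))"
    unfolding bruhat_cover_def comp_apply tt by (metis tt)
  also have "\<dots> \<longleftrightarrow> bruhat_cover v a b \<and> (v \<circ> transpose a b) (i + 1) < (v \<circ> transpose a b) i"
  proof (cases "a < b \<and> v a < v b")
    case False
    moreover have "t a < t b \<longleftrightarrow> a < b"
      using ne by (auto simp: t_def transpose_def)
    ultimately show ?thesis by (auto simp: bruhat_cover_def)
  next
    case True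
    then have ab: "t a < t b" using ne by (auto simp: t_def transpose_def)
    have vne: "v b \<noteq> v i" if "a = i + 1" using inj that True by (auto simp: inj_eq)
    have vne': "v a \<noteq> v (i + 1)" if "b = i" using inj that True by (auto simp: inj_eq)
    \<comment> \<open>If \<open>a = i\<close> or \<open>b = i + 1\<close>, the open interval loses
      one position, which cannot obstruct because \<open>v\<close> descends at \<open>i\<close>. If
      \<open>a = i + 1\<close> or \<open>b = i\<close>, it gains one, which obstructs exactly when
      the descent condition fails.\<close>
    consider "a \<notin> {i, i + 1}" "b \<notin> {i, i + 1}" | "a = i" "i + 1 < b" | "a = i + 1" "i + 1 < b"
      | "b = i" "a < i" | "b = i + 1" "a < i"
      using True ne by force
    then show ?thesis
    proof cases
      case 1
      then have "t a < t c \<and> t c < t b \<longleftrightarrow> a < c \<and> c < b" for c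
        by (auto simp: t_def transpose_def)
      then show ?thesis using 1 True ab desc by (simp add: bruhat_cover_def transpose_def)
    next
      case 2
      then have "t a < t c \<and> t c < t b \<longleftrightarrow> a < c \<and> c < b \<and> c \<noteq> i + 1" for c
        by (auto simp: t_def transpose_def)
      moreover have "(v \<circ> transpose a b) (i + 1) < (v \<circ> transpose a b) i" "\<not> v a < v (i + 1)"
        using 2 True desc by (simp_all add: transpose_def, linarith?)
      ultimately show ?thesis using True ab unfolding bruhat_cover_def by blast
    next
      case 3
      then have "t a < t c \<and> t c < t b \<longleftrightarrow> a < c \<and> c < b \<or> c = i" for c
        by (auto simp: t_def transpose_def)
      moreover have "(v \<circ> transpose a b) (i + 1) < (v \<circ> transpose a b) i \<longleftrightarrow> \<not> (v a < v i \<and> v i < v b)"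
        using 3 True desc vne by (simp_all add: transpose_def, linarith?)
      ultimately show ?thesis using True ab unfolding bruhat_cover_def by blast
    next
      case 4
      then have "t a < t c \<and> t c < t b \<longleftrightarrow> a < c \<and> c < b \<or> c = i + 1" for c
        by (auto simp: t_def transpose_def)
      moreover have "(v \<circ> transpose a b) (i + 1) < (v \<circ> transpose a b) i \<longleftrightarrow> \<not> (v a < v (i + 1) \<and> v (i + 1) < v b)"
        using 4 True desc vne' by (simp_all add: transpose_def, linarith?)
      ultimately show ?thesis using True ab unfolding bruhat_cover_def by blast
    next
      case 5
      then have "t a < t c \<and> t c < t b \<longleftrightarrow> a < c \<and> c < b \<and> c \<noteq> i" for c
        by (auto simp: t_def transpose_def)
      moreover have "(v \<circ> transpose a b) (i + 1) < (v \<circ> transpose a b) i" "\<not> v i < v b"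
        using 5 True desc by (simp_all add: transpose_def, linarith?)
      ultimately show ?thesis using True ab unfolding bruhat_cover_def by blast
    qed
  qed
  finally show ?thesis .
qed

lemma permutes_comp_transpose:
  "w permutes S \<Longrightarrow> a \<in> S \<Longrightarrow> b \<in> S \<Longrightarrow> (w \<circ> transpose a b) permutes S"
  by (intro permutes_compose permutes_swap_id)

text \<open>The only nonzero coefficient is at \<open>n + 1\<close>, and the resulting permutation
  is dominant with the code raised by one at \<open>r\<close>.\<close>

lemma monk_longest:
  assumes r: "r \<in> {1..n}"
  shows "var r * schubert n (longest_perm n) =
    (\<Sum>j\<in>{1..n + 1}. of_int (monk_coeff (longest_perm n) r j) *
       schubert (n + 1) (longest_perm n \<circ> transpose r j))"
proof -
  let ?w = "longest_perm n"
  define u where "u = ?w \<circ> transpose r (n + 1)"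
  have coeff: "monk_coeff ?w r j = (if j = n + 1 then 1 else 0)" if "j \<in> {1..n + 1}" for j
    using r that by (auto simp: monk_coeff_def bruhat_cover_def longest_perm_def)
  have pu: "u permutes {1..n + 1}"
    unfolding u_def
    by (rule permutes_comp_transpose[OF permutes_Suc[OF longest_perm_permutes]]) (use r in auto)
  have u_simps: "u k = (if k = r then n + 1 else if k = n + 1 then n + 1 - r else n + 1 - k)"
    if "k \<in> {1..n + 1}" for k
    using r that by (auto simp: u_def longest_perm_def transpose_def)
  have av: "avoids_132 (n + 1) u"
    unfolding avoids_132_def
  proof (intro allI impI)
    fix i j k assume ijk: "1 \<le> i \<and> i < j \<and> j < k \<and> k \<le> n + 1"
    then have "i \<in> {1..n + 1}" "j \<in> {1..n + 1}" "k \<in> {1..n + 1}" by auto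
    then show "\<not> (u i < u k \<and> u k < u j)"
      using ijk r by (auto simp: u_simps split: if_splits)
  qed
  have code: "lehmer_code (n + 1) u k = (n - k) + (if k = r then 1 else 0)"
    if k: "k \<in> {1..n + 1}" for k
  proof -
    \<comment> \<open>Position \<open>r\<close> holds the maximum \<open>n + 1\<close>, so it is
      never counted from the left; the last position holds \<open>n + 1 - r\<close>, which exceeds
      all values strictly between \<open>r\<close> and it.\<close>
    have eq: "{j. k < j \<and> j \<le> n + 1 \<and> u j < u k} =
        (if k < r then {k<..n + 1} - {r} else if k = r then {k<..n + 1} else {k<..n})"
    proof (rule set_eqI)
      fix j
      show "j \<in> {j. k < j \<and> j \<le> n + 1 \<and> u j < u k} \<longleftrightarrow>
        j \<in> (if k < r then {k<..n + 1} - {r} else if k = r then {k<..n + 1} else {k<..n})"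
      proof (cases "j \<in> {1..n + 1} \<and> k < j")
        case True
        then show ?thesis using k r by (auto simp: u_simps)
      next
        case False
        then show ?thesis using k r by auto
      qed
    qed
    show ?thesis unfolding lehmer_code_def eq using r k by (auto simp: card_Diff_singleton)
  qed
  have "(\<Sum>j\<in>{1..n + 1}. of_int (monk_coeff ?w r j) * schubert (n + 1) (?w \<circ> transpose r j)) =
      (\<Sum>j\<in>{1..n + 1}. if j = n + 1 then schubert (n + 1) u else 0)"
    by (rule sum.cong) (use coeff in \<open>auto simp: u_def\<close>)
  also have "\<dots> = schubert (n + 1) u"
    by simp
  also have "\<dots> = (\<Prod>k\<in>{1..n + 1}. var k ^ ((n - k) + (if k = r then 1 else 0)))"
    unfolding schubert_dominant[OF pu av] by (intro prod.cong refl) (simp only: code)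
  also have "\<dots> = (\<Prod>k\<in>{1..n + 1}. var k ^ (n - k) * (if k = r then var k else 1))"
    by (rule prod.cong) auto
  also have "\<dots> = (\<Prod>k\<in>{1..n + 1}. var k ^ (n - k)) * var r"
    unfolding prod.distrib using r by (simp add: prod.delta)
  also have "(\<Prod>k\<in>{1..n + 1}. var k ^ (n - k)) = schubert n ?w"
    using schubert_eqI[OF longest_perm_permutes is_schubert.longest] by simp
  finally show ?thesis by (simp only: mult.commute)
qed

text \<open>Termwise comparison for the induction in Monk's rule. If \<open>r\<close> and
  \<open>j\<close> are \<open>i\<close> and \<open>i + 1\<close>, the term is the Leibniz
  correction; otherwise \<open>divided_diff i\<close> retains exactly the covers selected by
  \<open>bruhat_cover_swap\<close>.\<close>

lemma monk_step:
  assumes v: "v permutes {1..n}" and i: "1 \<le> i" "i < n" and desc: "v (i + 1) < v i"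
    and j: "j \<in> {1..n + 1}" and r: "r \<in> {1..n}"
  defines "t \<equiv> transpose i (i + 1)"
  shows "of_int (monk_coeff (v \<circ> t) r j) * schubert (n + 1) (v \<circ> t \<circ> transpose r j) =
    of_int (monk_coeff v (t r) (t j)) * divided_diff i (schubert (n + 1) (v \<circ> transpose (t r) (t j))) +
    (if j = t r then of_int ((if r = i then 1 else 0) - (if r = i + 1 then 1 else 0)) * schubert n v else 0)"
proof (cases "{t r, t j} = {i, i + 1}")
  case True
  then have "t ` {t r, t j} = t ` {i, i + 1}" by (rule arg_cong)
  then have "{r, j} = {i + 1, i}" by (simp add: t_def)
  then have rj: "r = i \<and> j = i + 1 \<or> r = i + 1 \<and> j = i"
    unfolding doubleton_eq_iff by blast
  have cover: "bruhat_cover (v \<circ> t) i (i + 1)" "\<not> bruhat_cover (v \<circ> t) (i + 1) i"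
    "\<not> bruhat_cover v i (i + 1)" "\<not> bruhat_cover v (i + 1) i"
    using desc by (simp_all add: bruhat_cover_def t_def)
  from rj have "transpose r j = t" by (auto simp: t_def intro: transpose_commute)
  then have "v \<circ> t \<circ> transpose r j = v" by (simp add: t_def fun_eq_iff)
  then show ?thesis
    using rj cover schubert_stable[OF v] by (auto simp: monk_coeff_def t_def)
next
  case False
  have tt: "t (t c) = c" for c by (simp add: t_def)
  have jr: "of_int ((if r = i then 1 else 0) - (if r = i + 1 then 1 else 0)) = (0::int_mpoly)" if "j = t r"
    using that False by (auto simp: t_def)
  have vi: "inj v" using permutes_inj[OF v] .
  define u where "u = v \<circ> transpose (t r) (t j)"
  have mem: "t r \<in> {1..n + 1}" "t j \<in> {1..n + 1}"
    using i r j by (auto simp: t_def transpose_def)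
  have u: "u permutes {1..n + 1}"
    unfolding u_def by (rule permutes_comp_transpose[OF permutes_Suc[OF v] mem])
  have ut: "u \<circ> t = v \<circ> t \<circ> transpose r j"
  proof
    fix x
    have "t x = t c \<longleftrightarrow> x = c" for c by (metis tt)
    then show "(u \<circ> t) x = (v \<circ> t \<circ> transpose r j) x"
      by (simp add: u_def transpose_def)
  qed
  have c1: "bruhat_cover (v \<circ> t) r j \<longleftrightarrow> bruhat_cover v (t r) (t j) \<and> u (i + 1) < u i"
    using bruhat_cover_swap[OF vi desc False] by (simp add: t_def u_def)
  have c2: "bruhat_cover (v \<circ> t) j r \<longleftrightarrow> bruhat_cover v (t j) (t r) \<and> u (i + 1) < u i"
    using bruhat_cover_swap[OF vi desc, of "t j" "t r"] False
    by (simp add: t_def u_def insert_commute transpose_commute[of "transpose i (Suc i) r"])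
  have "divided_diff i (schubert (n + 1) u) = (if u (i + 1) < u i then schubert (n + 1) (u \<circ> t) else 0)"
    unfolding t_def by (rule divided_diff_schubert[OF u i(1)]) (use i in simp)
  then show ?thesis
    using jr unfolding monk_coeff_def c1 c2 u_def[symmetric] ut by auto
qed

theorem monk:
  assumes "v permutes {1..n}" "r \<in> {1..n}"
  shows "var r * schubert n v =
    (\<Sum>j\<in>{1..n + 1}. of_int (monk_coeff v r j) * schubert (n + 1) (v \<circ> transpose r j))"
  using assms
proof (induction "perm_weight n v" arbitrary: v r rule: less_induct)
  case less
  note w = less.prems(1) and r = less.prems(2)
  show ?case
  proof (cases "\<exists>i. 1 \<le> i \<and> i < n \<and> v i < v (i + 1)")
    case False
    then have "v = longest_perm n" using no_ascent_longest[OF w] by blast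
    then show ?thesis using monk_longest[OF r] by simp
  next
    case True
    then obtain i where i: "1 \<le> i" "i < n" "v i < v (i + 1)" by blast
    define t where "t = transpose i (i + 1)"
    define u where "u = v \<circ> t"
    let ?e = "of_int ((if r = i then 1 else 0) - (if r = i + 1 then 1 else 0)) :: int_mpoly"
    have u: "u permutes {1..n}" unfolding u_def t_def by (rule permutes_swap[OF w i(1,2)])
    have v: "v = u \<circ> t" by (auto simp: u_def t_def)
    have desc: "u (i + 1) < u i" using i by (simp add: u_def t_def)
    have tr: "t r \<in> {1..n}" using i r by (auto simp: t_def transpose_def)
    have tr1: "t r \<in> {1..n + 1}" using tr by simp
    have bij: "bij_betw t {1..n + 1} {1..n + 1}"
      unfolding t_def by (intro permutes_imp_bij permutes_swap_id) (use i in auto)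
    have Sv: "schubert n v = divided_diff i (schubert n u)"
      using schubert_ascent[OF w i] by (simp add: u_def t_def)
    have IH: "var (t r) * schubert n u =
        (\<Sum>j\<in>{1..n + 1}. of_int (monk_coeff u (t r) j) * schubert (n + 1) (u \<circ> transpose (t r) j))"
      using less.hyps[OF _ u tr] perm_weight_swap[OF i] by (simp add: u_def t_def)
    \<comment> \<open>The induction hypothesis is used at \<open>t r\<close>, since
      \<open>divided_diff i\<close> turns the factor \<open>var (t r)\<close> into
      \<open>var r\<close>; the correction for \<open>t r\<close> is minus that for
      \<open>r\<close>.\<close>
    have "var r * schubert n v = divided_diff i (var (t r) * schubert n u) + ?e * schubert n u"
      unfolding divided_diff_var_mult Sv t_def by (auto simp: transpose_def)
    also have "divided_diff i (var (t r) * schubert n u) =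
        (\<Sum>j\<in>{1..n + 1}. of_int (monk_coeff u (t r) j) *
          divided_diff i (schubert (n + 1) (u \<circ> transpose (t r) j)))"
      unfolding IH divided_diff_sum divided_diff_of_int_mult ..
    also have "\<dots> = (\<Sum>j\<in>{1..n + 1}. of_int (monk_coeff u (t r) (t j)) *
          divided_diff i (schubert (n + 1) (u \<circ> transpose (t r) (t j))))"
      by (rule sum.reindex_bij_betw[OF bij, symmetric])
    also have "?e * schubert n u = (\<Sum>j\<in>{1..n + 1}. if j = t r then ?e * schubert n u else 0)"
      using tr1 by (simp only: sum.delta finite_atLeastAtMost if_True)
    also have "(\<Sum>j\<in>{1..n + 1}. of_int (monk_coeff u (t r) (t j)) *
          divided_diff i (schubert (n + 1) (u \<circ> transpose (t r) (t j)))) +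
        (\<Sum>j\<in>{1..n + 1}. if j = t r then ?e * schubert n u else 0) =
        (\<Sum>j\<in>{1..n + 1}. of_int (monk_coeff v r j) * schubert (n + 1) (v \<circ> transpose r j))"
      unfolding sum.distrib[symmetric] v t_def
      by (rule sum.cong[OF refl], rule monk_step[OF u i(1,2) desc _ r, symmetric])
    finally show ?thesis .
  qed
qed


subsection \<open>Lascoux's transition and 132-patterns\<close>

lemma finite_132_patterns:
  fixes n :: nat and u :: "nat \<Rightarrow> nat"
  shows "finite {(i, j, k). 1 \<le> i \<and> i < j \<and> j < k \<and> k \<le> n \<and> u i < u k \<and> u k < u j}"
  by (rule finite_subset[of _ "{1..n} \<times> {1..n} \<times> {1..n}"]) auto

text \<open>The positions after \<open>r\<close> with values below \<open>w r\<close> are exactly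
  those from \<open>r + 1\<close> to \<open>s\<close>.\<close>

locale last_descent =
  fixes n :: nat and w :: "nat \<Rightarrow> nat" and r s :: nat
  assumes w: "w permutes {1..n}" and rs: "1 \<le> r" "r < s" "s \<le> n" "w s < w r"
    and increasing: "r < j \<Longrightarrow> j < k \<Longrightarrow> k \<le> n \<Longrightarrow> w j < w k"
    and larger_after: "s < j \<Longrightarrow> j \<le> n \<Longrightarrow> w r < w j"
begin

definition v :: "nat \<Rightarrow> nat" where "v = w \<circ> transpose r s"

lemma v_simps: "v r = w s" "v s = w r" "k \<noteq> r \<Longrightarrow> k \<noteq> s \<Longrightarrow> v k = w k"
  by (simp_all add: v_def)

lemma v_permutes: "v permutes {1..n}"
  unfolding v_def by (rule permutes_comp_transpose[OF w]) (use rs in auto)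

definition cover_positions :: "nat set" where
  "cover_positions = {q \<in> {1..<r}. bruhat_cover v q r}"

lemma transition:
  "schubert n w = var r * schubert n v + (\<Sum>q\<in>cover_positions. schubert n (v \<circ> transpose q r))"
proof -
  let ?f = "\<lambda>q. schubert n (v \<circ> transpose q r)"
  have vw: "v \<circ> transpose r s = w" by (simp add: v_def fun_eq_iff)
  have cover_s: "bruhat_cover v r s"
    unfolding bruhat_cover_def
  proof (intro conjI allI impI)
    show "\<not> (v r < v c \<and> v c < v s)" if "r < c \<and> c < s" for c
      using that rs increasing[of c s] by (simp add: v_simps)
  qed (use rs in \<open>simp_all add: v_simps\<close>)
  \<comment> \<open>Past \<open>s\<close>, including at the fixed point \<open>n + 1\<close>, the
    value exceeds \<open>v s\<close>, so \<open>s\<close> obstructs; between \<open>r\<close> and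
    \<open>s\<close> the values lie below \<open>v r = w s\<close>.\<close>
  have no_cover: "\<not> bruhat_cover v r j" if j: "j \<in> {1..n + 1}" "j \<noteq> s" for j
  proof (cases "s < j")
    case True
    have "w r \<le> n" using permutes_in_image[OF w, of r] rs by auto
    moreover have "v (n + 1) = n + 1" using permutes_not_in[OF v_permutes] by simp
    moreover have "j = n + 1 \<or> j \<le> n" using j by auto
    ultimately have "w r < v j" using True larger_after[of j] rs by (auto simp: v_simps)
    then show ?thesis using True rs unfolding bruhat_cover_def
      by (auto simp: v_simps intro!: exI[of _ s])
  next
    case False
    then show ?thesis using j rs increasing[of j s] unfolding bruhat_cover_def
      by (auto simp: v_simps)
  qed
  have "of_int (monk_coeff v r j) * schubert (n + 1) (v \<circ> transpose r j) =
      (if j = s then schubert n w else 0) - (if j \<in> cover_positions then ?f j else 0)"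
    if j: "j \<in> {1..n + 1}" for j
  proof (cases "j = s")
    case True
    have "s \<notin> cover_positions" using rs by (auto simp: cover_positions_def)
    then show ?thesis using True cover_s vw schubert_stable[OF w] by (simp add: monk_coeff_def)
  next
    case False
    show ?thesis
    proof (cases "bruhat_cover v j r")
      case True
      then have jr: "j < r" by (simp add: bruhat_cover_def)
      have "(v \<circ> transpose j r) permutes {1..n}"
        by (rule permutes_comp_transpose[OF v_permutes]) (use jr j rs in auto)
      then show ?thesis
        using jr j True False no_cover[OF j False]
        by (simp add: monk_coeff_def cover_positions_def schubert_stable[simplified]
            transpose_commute[of r j])
    next
      case not: False
      then show ?thesis using False no_cover[OF j False]
        by (simp add: monk_coeff_def cover_positions_def)
    qed
  qed
  then have "var r * schubert n v =
      (\<Sum>j\<in>{1..n + 1}. (if j = s then schubert n w else 0) - (if j \<in> cover_positions then ?f j else 0))"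
    using monk[OF v_permutes, of r] rs by simp
  also have "\<dots> = schubert n w - (\<Sum>j\<in>{1..n + 1}. if j \<in> cover_positions then ?f j else 0)"
    using rs by (simp only: sum_subtractf sum.delta finite_atLeastAtMost) simp
  also have "(\<Sum>j\<in>{1..n + 1}. if j \<in> cover_positions then ?f j else 0) = sum ?f cover_positions"
    unfolding sum.inter_restrict[OF finite_atLeastAtMost, symmetric]
    by (rule sum.cong) (use rs in \<open>auto simp: cover_positions_def\<close>)
  finally show ?thesis by simp
qed

lemma principal_spec_transition:
  "principal_spec n w = principal_spec n v +
     (\<Sum>q\<in>cover_positions. principal_spec n (v \<circ> transpose q r))"
  unfolding principal_spec_def
  by (subst transition) (simp add: subst_mpoly_add subst_mpoly_mult subst_mpoly_sum)

text \<open>The first positions of the 132-patterns \<open>(i, r, s)\<close> of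
  \<open>w\<close>.\<close>

definition small_positions :: "nat set" where
  "small_positions = {i \<in> {1..<r}. w i < w s}"

text \<open>
  Exchanging the values at \<open>r\<close> and \<open>s\<close> destroys only the patterns \<open>(i, r, s)\<close>; a pattern whose
  middle position precedes \<open>r\<close> survives once its last position is moved by the transposition.
\<close>

lemma count_132_le: "count_132 n w \<le> count_132 n v + card small_positions"
proof -
  let ?P = "\<lambda>u. {(i, j, k). 1 \<le> i \<and> i < j \<and> j < k \<and> k \<le> n \<and> u i < u k \<and> u k < (u j :: nat)}"
  let ?t = "transpose r s"
  define \<phi> where "\<phi> = (\<lambda>(i :: nat, j, k). (i, j, if j < r then ?t k else k))"
  let ?L = "(\<lambda>i. (i, r, s)) ` small_positions"
  have "inj_on \<phi> (?P w - ?L)"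
    by (rule inj_onI) (auto simp: \<phi>_def split: if_splits dest: injD[OF inj_transpose])
  moreover have "\<phi> ` (?P w - ?L) \<subseteq> ?P v"
  proof (rule image_subsetI)
    fix x assume "x \<in> ?P w - ?L"
    then obtain i j k where x: "x = (i, j, k)" and ijk: "1 \<le> i" "i < j" "j < k" "k \<le> n"
      "w i < w k" "w k < w j" and nl: "(i, j, k) \<notin> ?L" by auto
    have "j \<le> r" using increasing[of j k] ijk by force
    then consider "j < r" | "j = r" by linarith
    then show "\<phi> x \<in> ?P v"
    proof cases
      case 1
      then have "v i = w i" "v j = w j" using ijk rs by (auto simp: v_simps)
      moreover have "v (?t k) = w k" by (simp add: v_def)
      moreover have "j < ?t k" "?t k \<le> n" using 1 ijk rs by (auto simp: transpose_def)
      ultimately show ?thesis using 1 ijk by (simp add: x \<phi>_def)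
    next
      case 2
      \<comment> \<open>With middle position \<open>r\<close>, the last position cannot be
        \<open>s\<close>, as that triple was removed; hence \<open>w k < w s = v r\<close> and the
        pattern stays in place.\<close>
      have ks: "k \<le> s" using larger_after[of k] ijk 2 by force
      have "k \<noteq> s"
        using nl 2 ijk by (auto simp: small_positions_def)
      then have "k < s" using ks by simp
      then show ?thesis
        using 2 ijk rs increasing[of k s] by (simp add: x \<phi>_def v_simps)
    qed
  qed
  ultimately have "card (?P w - ?L) \<le> card (?P v)"
    using card_inj_on_le finite_132_patterns by blast
  moreover have "card (?P w) \<le> card (?P w - ?L) + card ?L"
    using card_Un_le[of "?P w - ?L" ?L] card_mono[of "(?P w - ?L) \<union> ?L" "?P w"] finite_132_patterns[of n w]
    by (force simp: small_positions_def)
  moreover have "card ?L \<le> card small_positions"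
    by (rule card_image_le) (simp add: small_positions_def)
  ultimately show ?thesis unfolding count_132_def by linarith
qed

lemma v_cover_simps:
  assumes "q \<in> cover_positions"
  shows "(v \<circ> transpose q r) permutes {1..n}" "(v \<circ> transpose q r) r = w q" "q < r" "w q < w s"
    "r < j \<Longrightarrow> (v \<circ> transpose q r) j = v j"
proof -
  have q: "1 \<le> q" "q < r" "bruhat_cover v q r" using assms by (auto simp: cover_positions_def)
  then show "q < r" "w q < w s" "(v \<circ> transpose q r) r = w q"
    using rs by (auto simp: bruhat_cover_def v_simps)
  show "(v \<circ> transpose q r) permutes {1..n}"
    by (rule permutes_comp_transpose[OF v_permutes]) (use q rs in auto)
  show "r < j \<Longrightarrow> (v \<circ> transpose q r) j = v j" using q by (simp add: transpose_def)
qed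

text \<open>The exchange puts \<open>w s\<close> at \<open>q\<close> and \<open>w q\<close> at
  \<open>r\<close>, so each such \<open>i\<close> gives the pattern
  \<open>(i, q, r)\<close>.\<close>

lemma count_132_cover_ge:
  assumes q: "q \<in> cover_positions"
  shows "card {i \<in> small_positions. i < q \<and> w i < w q} \<le> count_132 n (v \<circ> transpose q r)"
proof -
  let ?u = "v \<circ> transpose q r"
  note qs = v_cover_simps[OF q]
  have uq: "?u q = w s" using rs by (simp add: v_simps)
  have "(\<lambda>i. (i, q, r)) ` {i \<in> small_positions. i < q \<and> w i < w q} \<subseteq>
      {(i, j, k). 1 \<le> i \<and> i < j \<and> j < k \<and> k \<le> n \<and> ?u i < ?u k \<and> ?u k < ?u j}"
  proof (rule image_subsetI)
    fix i assume i: "i \<in> {i \<in> small_positions. i < q \<and> w i < w q}"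
    then have "?u i = w i" using qs rs by (simp add: v_simps)
    then show "(i, q, r) \<in> {(i, j, k). 1 \<le> i \<and> i < j \<and> j < k \<and> k \<le> n \<and> ?u i < ?u k \<and> ?u k < ?u j}"
      using i qs uq rs by (simp add: small_positions_def del: comp_apply)
  qed
  then show ?thesis
    unfolding count_132_def by (rule card_inj_on_le[OF _ _ finite_132_patterns, rotated]) (simp add: inj_on_def)
qed

lemma small_positions_covered:
  "small_positions \<subseteq> (\<Union>q\<in>cover_positions. insert q {i \<in> small_positions. i < q \<and> w i < w q})"
proof
  fix i assume i: "i \<in> small_positions"
  \<comment> \<open>A \<open>q\<close> of largest value in \<open>?A\<close> is a cover position: an
    obstruction between \<open>q\<close> and \<open>r\<close> would be a member of \<open>?A\<close>
    with a larger value.\<close>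
  let ?A = "{q \<in> small_positions. i \<le> q \<and> w i \<le> w q}"
  have "finite ?A" "?A \<noteq> {}" using i by (auto simp: small_positions_def)
  then obtain q where q: "q \<in> ?A" and max: "\<And>c. c \<in> ?A \<Longrightarrow> w c \<le> w q"
    using Max_in[of "w ` ?A"] Max_ge[of "w ` ?A"] by (smt (verit) finite_imageI image_iff image_is_empty)
  have "bruhat_cover v q r"
    unfolding bruhat_cover_def
  proof (intro conjI allI impI notI)
    show "q < r" "v q < v r" using q rs by (auto simp: small_positions_def v_simps)
    fix c assume c: "q < c \<and> c < r" "v q < v c \<and> v c < v r"
    then have "w q < w c \<and> w c < w s" using q rs by (auto simp: v_simps)
    then show False using max[of c] c q by (auto simp: small_positions_def)
  qed
  then have "q \<in> cover_positions" using q by (auto simp: cover_positions_def small_positions_def)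
  moreover have "i = q \<or> i < q \<and> w i < w q"
    using q permutes_inj[OF w] by (auto simp: inj_eq le_less)
  ultimately show "i \<in> (\<Union>q\<in>cover_positions. insert q {i \<in> small_positions. i < q \<and> w i < w q})"
    using i by blast
qed

text \<open>The summand 1 pays for \<open>q\<close> itself, the pattern count for the small
  positions to its left and below it.\<close>

lemma card_small_positions_le:
  "card small_positions \<le> (\<Sum>q\<in>cover_positions. count_132 n (v \<circ> transpose q r) + 1)"
proof -
  let ?B = "\<lambda>q. {i \<in> small_positions. i < q \<and> w i < w q}"
  have fin: "finite cover_positions" "finite small_positions"
    by (auto simp: cover_positions_def small_positions_def)
  have "card small_positions \<le> card (\<Union>q\<in>cover_positions. insert q (?B q))"
    by (rule card_mono[OF _ small_positions_covered]) (use fin in auto)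
  also have "\<dots> \<le> (\<Sum>q\<in>cover_positions. card (insert q (?B q)))"
    by (rule card_UN_le[OF fin(1)])
  also have "\<dots> \<le> (\<Sum>q\<in>cover_positions. count_132 n (v \<circ> transpose q r) + 1)"
  proof (rule sum_mono)
    fix q assume "q \<in> cover_positions"
    then show "card (insert q (?B q)) \<le> count_132 n (v \<circ> transpose q r) + 1"
      using count_132_cover_ge[of q] fin by (simp add: card_insert_if)
  qed
  finally show ?thesis .
qed

lemma v_increasing: "r < j \<Longrightarrow> j < k \<Longrightarrow> k \<le> n \<Longrightarrow> v j < v k"
  using increasing[of j k] increasing[of j s] larger_after[of k] rs
  by (cases "j = s"; cases "k = s") (auto simp: v_simps)

end

section \<open>The lexicographic induction\<close>

lemma increasing_permutes_id:
  fixes n :: nat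
  assumes w: "w permutes {1..n}" and inc: "\<And>j k. 0 < j \<Longrightarrow> j < k \<Longrightarrow> k \<le> n \<Longrightarrow> w j < w k"
  shows "w = id"
proof
  fix i
  show "w i = id i"
  proof (cases "i \<in> {1..n}")
    case True
    \<comment> \<open>The difference of \<open>w i\<close> and \<open>i\<close> is weakly
      increasing, and it is squeezed to zero by \<open>w 1\<close> being at least 1 and
      \<open>w n\<close> at most \<open>n\<close>.\<close>
    have "w j + i \<le> w i + j" if "1 \<le> j" "j \<le> i" for j
      using that(2,1) True
    proof (induction i rule: dec_induct)
      case (step m)
      then show ?case using inc[of m "Suc m"] by auto
    qed simp
    from this[of 1] have "i \<le> w i" using permutes_in_image[OF w, of 1] True by auto
    have "w i + k \<le> w k + i" if "i \<le> k" "k \<le> n" for k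
      using that
    proof (induction k rule: dec_induct)
      case (step m)
      then show ?case using inc[of m "Suc m"] True by auto
    qed simp
    from this[of n] have "w i \<le> i" using permutes_in_image[OF w, of n] True by auto
    with \<open>i \<le> w i\<close> show ?thesis by simp
  next
    case False
    then show ?thesis using permutes_not_in[OF w] by simp
  qed
qed

lemma principal_spec_ge_increasing_after:
  assumes "w permutes {1..n}" "r \<le> n"
    and "\<And>j k. r < j \<Longrightarrow> j < k \<Longrightarrow> k \<le> n \<Longrightarrow> w j < w k"
  shows "int (count_132 n w) + 1 \<le> principal_spec n w"
  using assms
proof (induction r arbitrary: w)
  case 0
  then have "w = id" using increasing_permutes_id by blast
  moreover have "{(i, j, k). 1 \<le> i \<and> i < j \<and> j < k \<and> k \<le> n \<and> id i < id k \<and> id k < id j} = {}"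
    by auto
  ultimately show ?case
    by (simp only: principal_spec_def schubert_id count_132_def subst_mpoly_1) simp
next
  case (Suc r')
  define r where "r = Suc r'"
  from Suc.prems have "w permutes {1..n}" "\<And>j k. r < j \<Longrightarrow> j < k \<Longrightarrow> k \<le> n \<Longrightarrow> w j < w k"
    by (auto simp: r_def)
  then show ?case
  proof (induction "w r" arbitrary: w rule: less_induct)
    case less
    note w = less.prems(1) and inc = less.prems(2)
    let ?A = "{j. r < j \<and> j \<le> n \<and> w j < w r}"
    show ?case
    proof (cases "?A = {}")
      \<comment> \<open>No descent at \<open>r\<close> remains, so the outer hypothesis for
        \<open>r'\<close> applies.\<close>
      case True
      have "w j < w k" if "r' < j" "j < k" "k \<le> n" for j k
      proof (cases "j = r")
        case True
        then have "\<not> w k < w r" using \<open>?A = {}\<close> that by auto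
        moreover have "w k \<noteq> w r" using permutes_inj[OF w] that True by (simp add: inj_eq)
        ultimately show ?thesis using True by simp
      next
        case False
        then show ?thesis using inc that by (simp add: r_def)
      qed
      then show ?thesis using Suc.IH[OF w] Suc.prems(2) by simp
    next
      case False
      define s where "s = Max ?A"
      have fin: "finite ?A" by simp
      have sA: "s \<in> ?A" unfolding s_def by (rule Max_in[OF fin False])
      interpret last_descent n w r s
      proof
        show "w permutes {1..n}" by (rule w)
        show "1 \<le> r" by (simp add: r_def)
        show "r < s" "s \<le> n" "w s < w r" using sA by auto
        show "w j < w k" if "r < j" "j < k" "k \<le> n" for j k using inc that by blast
        show "w r < w j" if "s < j" "j \<le> n" for j
        proof -
          have "j \<notin> ?A" using Max_ge[OF fin, of j] that(1) unfolding s_def by linarith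
          moreover have "w j \<noteq> w r" using permutes_inj[OF w] that sA by (auto simp: inj_eq)
          ultimately show ?thesis using that sA by auto
        qed
      qed
      \<comment> \<open>The inner induction applies because \<open>v r = w s\<close> is below
        \<open>w r\<close>; for the covers below, the value at \<open>r\<close> is
        \<open>w q\<close>, which is smaller still.\<close>
      have v_ge: "int (count_132 n v) + 1 \<le> principal_spec n v"
        using less.hyps[OF _ v_permutes v_increasing] rs by (simp add: v_simps)
      have cover_ge: "int (count_132 n (v \<circ> transpose q r) + 1) \<le> principal_spec n (v \<circ> transpose q r)"
        if q: "q \<in> cover_positions" for q
      proof -
        note qs = v_cover_simps[OF q]
        have "(v \<circ> transpose q r) r < w r" using qs(2,4) rs by simp
        moreover have "(v \<circ> transpose q r) j < (v \<circ> transpose q r) k"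
          if "r < j" "j < k" "k \<le> n" for j k
          using v_increasing[OF that] qs(5)[of j] qs(5)[of k] that by simp
        ultimately show ?thesis using less.hyps[OF _ qs(1)] by simp
      qed
      have "int (count_132 n w) + 1 \<le> int (count_132 n v) + 1 + int (card small_positions)"
        using count_132_le by simp
      also have "\<dots> \<le> principal_spec n v +
          int (\<Sum>q\<in>cover_positions. count_132 n (v \<circ> transpose q r) + 1)"
        using v_ge card_small_positions_le by linarith
      also have "\<dots> \<le> principal_spec n v + (\<Sum>q\<in>cover_positions. principal_spec n (v \<circ> transpose q r))"
        unfolding int_sum by (intro add_left_mono sum_mono cover_ge)
      also have "\<dots> = principal_spec n w"
        by (rule principal_spec_transition[symmetric])
      finally show ?thesis .
    qed
  qed
qed

theorem theorem1p1:
  fixes n :: nat and w :: "nat \<Rightarrow> nat"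
  assumes "n \<ge> 1" and "w permutes {1..n}"
  shows "principal_spec n w \<ge> int (count_132 n w) + 1"
  \<comment> \<open>Starting from \<open>r = n\<close> makes the monotonicity hypothesis
    vacuous.\<close>
  using principal_spec_ge_increasing_after[OF assms(2) order_refl] by simp

end
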